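(* If $\lambda\in\mathbb{C}$, $k\in\mathbb{N}_0$, and $x\in(0,1)$, then the following connecting formulas are valid: $$\sum_{n=0}^{2k+1}\frac{(\lambda)_n\,\mathcal{G}_n\left(-2k-\lambda-\frac12,\lambda-\frac12,\sqrt{\frac{1-x}{1+x}}\right)}{(2\lambda+2k+1)_n\,(-2)^{-n}(1-x^2)^{-\frac n2}x^n}\,C_{2k-n+1}^{\lambda+n}\!\left(\frac1x\right)=0,$$ $$\sum_{n=0}^{2k+1}\frac{(\lambda)_n\,\widehat{\mathcal{G}}_n\left(-2k-\lambda-\frac12,\lambda-\frac12,\sqrt{\frac{1-x}{1+x}}\right)}{(2\lambda+2k+1)_n\,(-2)^{-n}(1-x^2)^{-\frac n2}}\,C_{2k-n+1}^{\lambda+n}(x)=0.$$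
   Context: $\mathbb{N}_0=\{0,1,2,\dots\}$; $(a)_n=\Gamma(a+n)/\Gamma(a)=a(a+1)\cdots(a+n-1)$, $(a)_0=1$. $C_k^{\lambda}(x)=\sum_{j=0}^{[k/2]}\frac{(-1)^j(\lambda)_{k-j}}{j!\,(k-2j)!}(2x)^{k-2j}$ is the Gegenbauer polynomial ($[\cdot]$ is the integer part). The functions $\mathcal{G}_n(\tau,\rho,w)$ and $\widehat{\mathcal{G}}_n(\tau,\rho,\eta)$ are the Maclaurin coefficients $$(1-wz)^{\tau}\left(1+\frac zw\right)^{-\tau}(1+z^2)^{-\rho}=\sum_{n=0}^\infty\mathcal{G}_n(\tau,\rho,w)z^n,$$ $$(1+\eta\zeta)^{\tau}\left(1+\frac\zeta\eta\right)^{-\tau}(1-\zeta^2)^{-\rho}=\sum_{n=0}^\infty\widehat{\mathcal{G}}_n(\tau,\rho,\eta)\zeta^n,$$ for small $|z|,|\zeta|$, each factor being $1$ at $0$.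
   Formalization: The formulas are proved for those complex λ for which every denominator (2λ+2k+1)_n, 0≤n≤2k+1, is nonzero; for the finitely many other λ (2λ+2k+1 ∈ {0,−1,…,−2k}) the displayed sums divide by zero and are undefined. *)

theory Defs
  imports "HOL-Complex_Analysis.Complex_Analysis"
begin

definition gegenbauer :: "nat \<Rightarrow> complex \<Rightarrow> complex \<Rightarrow> complex" where
  "gegenbauer k l x =
     (\<Sum>j\<le>k div 2. (-1) ^ j * pochhammer l (k - j) / (fact j * fact (k - 2 * j))
        * (2 * x) ^ (k - 2 * j))"

text \<open>The complex power \<open>powr\<close> is taken on the principal branch, so for \<open>w \<noteq> 0\<close> every factor
  below is holomorphic near \<open>0\<close> with value \<open>1\<close> at \<open>0\<close>.\<close>

definition genfun_G :: "complex \<Rightarrow> complex \<Rightarrow> complex \<Rightarrow> complex \<Rightarrow> complex" where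
  "genfun_G t r w z =
     (1 - w * z) powr t * (1 + z / w) powr (- t) * (1 + z\<^sup>2) powr (- r)"

definition genfun_G_hat :: "complex \<Rightarrow> complex \<Rightarrow> complex \<Rightarrow> complex \<Rightarrow> complex" where
  "genfun_G_hat t r e z =
     (1 + e * z) powr t * (1 + z / e) powr (- t) * (1 - z\<^sup>2) powr (- r)"

definition coeff_G :: "nat \<Rightarrow> complex \<Rightarrow> complex \<Rightarrow> complex \<Rightarrow> complex" where
  "coeff_G n t r w = fps_nth (fps_expansion (genfun_G t r w) 0) n"

definition coeff_G_hat :: "nat \<Rightarrow> complex \<Rightarrow> complex \<Rightarrow> complex \<Rightarrow> complex" where
  "coeff_G_hat n t r e = fps_nth (fps_expansion (genfun_G_hat t r e) 0) n"

lemma has_fps_expansion_imp_eventually_sums: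
  fixes f :: "complex \<Rightarrow> complex"
  assumes "f has_fps_expansion F"
  shows "\<forall>\<^sub>F z in nhds 0. (\<lambda>n. fps_nth F n * z ^ n) sums f z"
proof -
  have "0 \<in> eball (0 :: complex) (fps_conv_radius F)"
    using assms by (simp add: has_fps_expansion_def zero_ereal_def in_eball_iff)
  hence "\<forall>\<^sub>F z in nhds 0. z \<in> eball 0 (fps_conv_radius F)"
    by (intro eventually_nhds_in_open) auto
  moreover have "\<forall>\<^sub>F z in nhds 0. eval_fps F z = f z"
    using assms by (simp add: has_fps_expansion_def)
  ultimately show ?thesis
  proof eventually_elim
    case (elim z)
    thus ?case using sums_eval_fps[of z F] by (simp add: in_eball_iff)
  qed
qed

lemma eventually_sums_coeff_G:
  assumes "w \<noteq> 0"
  shows "\<forall>\<^sub>F z in nhds 0. (\<lambda>n. coeff_G n t r w * z ^ n) sums genfun_G t r w z"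
proof -
  have "genfun_G t r w analytic_on {0}"
    unfolding genfun_G_def using assms by (auto intro!: analytic_intros)
  thus ?thesis
    unfolding coeff_G_def
    by (intro has_fps_expansion_imp_eventually_sums analytic_at_imp_has_fps_expansion_0)
qed

lemma eventually_sums_coeff_G_hat:
  assumes "e \<noteq> 0"
  shows "\<forall>\<^sub>F z in nhds 0. (\<lambda>n. coeff_G_hat n t r e * z ^ n) sums genfun_G_hat t r e z"
proof -
  have "genfun_G_hat t r e analytic_on {0}"
    unfolding genfun_G_hat_def using assms by (auto intro!: analytic_intros)
  thus ?thesis
    unfolding coeff_G_hat_def
    by (intro has_fps_expansion_imp_eventually_sums analytic_at_imp_has_fps_expansion_0)
qed

end

theory Submission
  imports Defs
begin

text \<open>
  Write \<open>K = 2k + 1\<close>, \<open>c = 2l + K\<close> and \<open>\<tau> = 1/2 - l - K\<close>, which is the first parameter of both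
  coefficient sequences. In both formulas the sum is a multiple of the coefficient of \<open>z\<^sup>K\<close> in a
  formal power series, and that series is even while \<open>K\<close> is odd.

  Both sums have the form
  \<open>\<Sum>n\<le>K. (l)\<^sub>n a\<^sub>n (-2t)\<^sup>n / (c)\<^sub>n \<cdot> C\<^bsub>K-n\<^esub>\<^bsup>l+n\<^esup>(y)\<close>, where \<open>a\<^sub>n\<close> are the coefficients of
  \<open>A(z) = (1 + uz)\<^sup>\<tau> (1 + vz)\<^bsup>-\<tau>\<^esup> \<cdot> (even series)\<close> with \<open>tu = 1 - y\<close> and \<open>tv = 1 + y\<close>. With
  \<open>s = sqrt (1 - x\<^sup>2)\<close>, the first formula has \<open>y = 1/x\<close>, \<open>t = s/x\<close> and the second has \<open>y = x\<close>, \<open>t = s\<close>.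

  Expanding each Gegenbauer polynomial in powers of \<open>y\<^sup>2 - 1\<close> and \<open>y\<close>
  (\<open>gegenbauer_eq_sum_square_minus_one\<close>) gives a double sum over \<open>n\<close> and \<open>j\<close>. The duplication
  formula turns all its Pochhammer symbols into a factor free of \<open>n\<close> and \<open>j\<close> times
  \<open>(-4)\<^bsup>-(n+j)\<^esup> (\<tau>)\<^bsub>K-n-j\<^esub>\<close> (\<open>pochhammer_weight_eq\<close>). The numbers \<open>(\<tau>)\<^sub>q / q!\<close> are the coefficients of
  \<open>(1 - z)\<^bsup>-\<tau>\<^esup>\<close>, so the double sum is, up to this factor, the coefficient of \<open>z\<^sup>K\<close> in
  \<open>A(tz/2) (1 - yz + (y\<^sup>2 - 1) z\<^sup>2/4)\<^bsup>-\<tau>\<^esup>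
     = A(tz/2) (1 - (y + 1)z/2)\<^bsup>-\<tau>\<^esup> (1 - (y - 1)z/2)\<^bsup>-\<tau>\<^esup>\<close>
  (\<open>gegenbauer_sum_eq_coefficient\<close>). As
  \<open>A(tz/2) = (1 - (y - 1)z/2)\<^sup>\<tau> (1 + (y + 1)z/2)\<^bsup>-\<tau>\<^esup> \<cdot> (even series)\<close>, two factors cancel and the
  other two combine to \<open>(1 - ((y + 1)z/2)\<^sup>2)\<^bsup>-\<tau>\<^esup>\<close>, which is even (\<open>gegenbauer_sum_eq_0\<close>).
\<close>

\<comment> \<open>The symbol \<open>$\<close> is the coefficient of a formal power series throughout.\<close>
unbundle no vec_syntax

section \<open>Binomial powers of formal power series\<close>

text \<open>
  For \<open>f\<close> without constant term, \<open>fps_binomial c oo f\<close> is the power \<open>(1 + f)\<^sup>c\<close>. In the next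
  lemma the terms with \<open>i > n\<close> vanish since \<open>g ^ i\<close> is divisible by \<open>fps_X ^ i\<close>; this is what makes
  the infinite sum \<open>F \<cdot> A(g)\<close> finite in each coefficient.
\<close>

lemma fps_mult_compose_nth:
  fixes F A g :: "'a::comm_ring_1 fps"
  assumes "g $ 0 = 0"
  shows "(F * (A oo g)) $ n = (\<Sum>i\<le>n. A $ i * (F * g ^ i) $ n)"
proof -
  have "(A oo g) $ m = (\<Sum>i\<le>n. A $ i * (g ^ i) $ m)" if "m \<le> n" for m
    unfolding fps_compose_nth
    by (rule sum.mono_neutral_left)
      (use that startsby_zero_power_prefix[OF assms] in auto)
  hence "(F * (A oo g)) $ n = (\<Sum>k=0..n. F $ k * (\<Sum>i\<le>n. A $ i * (g ^ i) $ (n - k)))"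
    by (simp add: fps_mult_nth)
  also have "\<dots> = (\<Sum>i\<le>n. A $ i * (\<Sum>k=0..n. F $ k * (g ^ i) $ (n - k)))"
    unfolding sum_distrib_left by (subst sum.swap) (simp add: mult_ac)
  finally show ?thesis by (simp add: fps_mult_nth)
qed

lemma fps_binomial_compose_ODE:
  fixes f :: "'a::field_char_0 fps"
  assumes "f $ 0 = 0"
  shows "fps_deriv (fps_binomial c oo f) * (1 + f) = fps_const c * (fps_binomial c oo f) * fps_deriv f"
proof -
  have "fps_deriv (fps_binomial c) * (1 + fps_X) = fps_const c * fps_binomial c"
    by (simp add: fps_binomial_deriv fps_divide_unit mult.assoc inverse_mult_eq_1)
  hence "(fps_deriv (fps_binomial c) * (1 + fps_X)) oo f = (fps_const c * fps_binomial c) oo f"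
    by simp
  hence "(fps_deriv (fps_binomial c) oo f) * (1 + f) = fps_const c * (fps_binomial c oo f)"
    using assms by (simp add: fps_compose_mult_distrib fps_compose_add_distrib)
  thus ?thesis
    using assms by (simp add: fps_compose_deriv mult_ac)
qed

text \<open>
  The differential equation is linear of first order: the Wronskian \<open>F' G - F G'\<close> of two solutions
  is zero, so their quotient is constant.
\<close>

lemma fps_binomial_compose_ODE_unique:
  fixes F G h :: "'a::field_char_0 fps"
  assumes F: "fps_deriv F * (1 + h) = fps_const c * F * fps_deriv h"
    and G: "fps_deriv G * (1 + h) = fps_const c * G * fps_deriv h"
    and "h $ 0 = 0" "F $ 0 = G $ 0" "G $ 0 \<noteq> 0"
  shows "F = G"
proof -
  have "(fps_deriv F * G - F * fps_deriv G) * (1 + h)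
          = (fps_deriv F * (1 + h)) * G - F * (fps_deriv G * (1 + h))"
    by (simp add: algebra_simps)
  also have "\<dots> = 0"
    unfolding F G by (simp add: algebra_simps)
  finally have wronskian: "fps_deriv F * G - F * fps_deriv G = 0"
    using \<open>h $ 0 = 0\<close> by (auto dest: arg_cong[where f = "\<lambda>f. fps_nth f 0"])
  have "fps_deriv (F * inverse G) = (fps_deriv F * G - F * fps_deriv G) * inverse G ^ 2"
    using \<open>G $ 0 \<noteq> 0\<close> inverse_mult_eq_1[of G]
    by (simp add: fps_inverse_deriv algebra_simps power2_eq_square)
  hence "F * inverse G = fps_const ((F * inverse G) $ 0)"
    by (simp only: wronskian mult_zero_left fps_deriv_eq_0_iff)
  hence "F * inverse G = 1"
    using assms by simp
  hence "F * (inverse G * G) = G"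
    by (simp add: mult.assoc [symmetric])
  thus ?thesis
    using inverse_mult_eq_1[OF \<open>G $ 0 \<noteq> 0\<close>] by simp
qed

text \<open>
  This is the rule \<open>((1 + f)(1 + g))\<^sup>c = (1 + f)\<^sup>c (1 + g)\<^sup>c\<close>. For formal power series it has no branch
  conditions; both sides solve the same differential equation.
\<close>

lemma fps_binomial_compose_mult:
  fixes f g :: "'a::field_char_0 fps"
  assumes "f $ 0 = 0" "g $ 0 = 0"
  shows "fps_binomial c oo (f + g + f * g) = (fps_binomial c oo f) * (fps_binomial c oo g)"
proof (rule fps_binomial_compose_ODE_unique)
  let ?F = "fps_binomial c oo f" and ?G = "fps_binomial c oo g" and ?h = "f + g + f * g"
  show "fps_deriv (fps_binomial c oo ?h) * (1 + ?h)
          = fps_const c * (fps_binomial c oo ?h) * fps_deriv ?h"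
    using assms by (intro fps_binomial_compose_ODE) simp
  have "fps_deriv (?F * ?G) * (1 + ?h)
          = (fps_deriv ?F * (1 + f)) * ?G * (1 + g) + ?F * (1 + f) * (fps_deriv ?G * (1 + g))"
    by (simp add: algebra_simps)
  also have "\<dots> = fps_const c * (?F * ?G) * fps_deriv ?h"
    unfolding fps_binomial_compose_ODE[OF assms(1)] fps_binomial_compose_ODE[OF assms(2)]
    by (simp add: algebra_simps)
  finally show "fps_deriv (?F * ?G) * (1 + ?h) = fps_const c * (?F * ?G) * fps_deriv ?h" .
qed (use assms in auto)

lemma fps_binomial_compose_add:
  fixes f :: "'a::field_char_0 fps"
  assumes "f $ 0 = 0"
  shows "fps_binomial (c + d) oo f = (fps_binomial c oo f) * (fps_binomial d oo f)"
  using assms by (simp add: fps_binomial_add_mult fps_compose_mult_distrib)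

lemma fps_compose_monomial_dilate:
  fixes f :: "'a::idom fps"
  shows "(f oo (fps_const a * fps_X ^ Suc n)) oo (fps_const b * fps_X)
           = f oo (fps_const (a * b ^ Suc n) * fps_X ^ Suc n)"
proof -
  have "(fps_const a * fps_X ^ Suc n) oo (fps_const b * fps_X) = fps_const a * (fps_const b * fps_X) ^ Suc n"
    by (simp add: fps_compose_mult_distrib flip: fps_compose_power del: power_Suc)
  thus ?thesis
    by (simp add: fps_compose_assoc [symmetric] power_mult_distrib fps_const_power del: power_Suc)
      (simp add: mult_ac flip: fps_const_mult)
qed

section \<open>Gegenbauer polynomials\<close>

lemma linear_fps_power_nth:
  fixes a b :: "'a::comm_ring_1"
  shows "((fps_const a + fps_const b * fps_X) ^ n) $ j = of_nat (n choose j) * a ^ (n - j) * b ^ j"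
proof -
  have "(fps_const b * fps_X + fps_const a) ^ n
     = (\<Sum>k\<le>n. fps_const (of_nat (n choose k) * b ^ k * a ^ (n - k)) * fps_X ^ k)"
    unfolding binomial_ring
    by (intro sum.cong)
      (auto simp: power_mult_distrib fps_const_power fps_of_nat [symmetric] mult_ac simp flip: fps_const_mult)
  also have "\<dots> $ j = (\<Sum>k\<le>n. if j = k then of_nat (n choose k) * b ^ k * a ^ (n - k) else 0)"
    unfolding fps_sum_nth by (intro sum.cong) auto
  also have "\<dots> = of_nat (n choose j) * a ^ (n - j) * b ^ j"
    by (cases "j \<le> n") (auto simp: binomial_eq_0)
  finally show ?thesis by (simp add: add.commute)
qed

text \<open>
  The classical generating function \<open>(1 - 2yX + X\<^sup>2)\<^bsup>-v\<^esup>\<close>. The inner series is \<open>X (X - 2y)\<close>, and the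
  defining sum appears when each power of \<open>X - 2y\<close> is expanded by the binomial theorem.
\<close>

lemma gegenbauer_generating_function:
  "(fps_binomial (- v) oo (fps_const (- 2 * y) * fps_X + fps_X ^ 2)) $ m = gegenbauer m v y"
proof -
  define d where "d = fps_const (- 2 * y) + fps_const 1 * fps_X"
  have "fps_const (- 2 * y) * fps_X + fps_X ^ 2 = fps_X * d"
    by (simp add: d_def algebra_simps power2_eq_square)
  hence "(fps_binomial (- v) oo (fps_const (- 2 * y) * fps_X + fps_X ^ 2)) $ m
      = (\<Sum>i=0..m. (- v gchoose i) * (d ^ i) $ (m - i))"
    by (auto simp: fps_compose_nth power_mult_distrib fps_X_power_mult_nth intro!: sum.cong)
  also have "\<dots> = (\<Sum>i=0..m. (- v gchoose (m - i)) * (d ^ (m - i)) $ i)"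
    by (subst sum.atLeastAtMost_rev) simp
  also have "\<dots> = (\<Sum>i\<le>m div 2. (- v gchoose (m - i)) * (d ^ (m - i)) $ i)"
    unfolding d_def linear_fps_power_nth
    by (rule sum.mono_neutral_right) (auto simp: binomial_eq_0)
  also have "\<dots> = gegenbauer m v y"
    unfolding gegenbauer_def
  proof (rule sum.cong)
    fix j assume "j \<in> {..m div 2}"
    hence "2 * j \<le> m" by auto
    then obtain r where m: "m = 2 * j + r" using le_Suc_ex by blast
    have d_nth: "(d ^ (m - j)) $ j = of_nat ((r + j) choose j) * ((-1) ^ r * (2 * y) ^ r)"
      using power_mult_distrib[of "-1" "2 * y" r]
      unfolding d_def by (subst linear_fps_power_nth) (simp add: m add.commute)
    have choose: "of_nat ((r + j) choose j) = (fact (r + j) / (fact j * fact r) :: complex)"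
      by (simp add: binomial_fact)
    have gchoose: "(- v gchoose (m - j)) = (-1) ^ (r + j) * pochhammer v (r + j) / fact (r + j)"
      using m by (simp add: gbinomial_pochhammer add.commute[of r j])
    have "(- v gchoose (m - j)) * (d ^ (m - j)) $ j
        = ((-1) ^ (r + j) * (-1) ^ r) * pochhammer v (r + j) / (fact j * fact r) * (2 * y) ^ r"
      unfolding d_nth choose gchoose by simp
    also have "(-1) ^ (r + j) * (-1) ^ r = ((-1) ^ j :: complex)"
      by (cases "even r"; cases "even j") simp_all
    finally show "(- v gchoose (m - j)) * (d ^ (m - j)) $ j =
       (-1) ^ j * pochhammer v (m - j) / (fact j * fact (m - 2 * j)) * (2 * y) ^ (m - 2 * j)"
      using m by (simp add: add.commute[of r j])
  qed simp
  finally show ?thesis .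
qed

text \<open>
  The reason is the other way to split the generating function:
  \<open>1 - 2yX + X\<^sup>2 = (1 - yX)\<^sup>2 - (y\<^sup>2 - 1) X\<^sup>2\<close>, so that
  \<open>(1 - 2yX + X\<^sup>2)\<^bsup>-v\<^esup> = \<Sum>j. (v)\<^sub>j / j! \<cdot> (y\<^sup>2 - 1)\<^sup>j X\<^bsup>2j\<^esup> (1 - yX)\<^bsup>-2v-2j\<^esup>\<close>. The resulting formula
  contains no Pochhammer symbol in a denominator, so it holds for every complex \<open>v\<close>.
\<close>

lemma gegenbauer_eq_sum_square_minus_one:
  "gegenbauer m v y =
     (\<Sum>j\<le>m div 2. pochhammer v j * pochhammer (2 * v + 2 * of_nat j) (m - 2 * j)
        / (fact j * fact (m - 2 * j)) * (y\<^sup>2 - 1) ^ j * y ^ (m - 2 * j))"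
proof -
  define f where "f = fps_const (- y) * (fps_X :: complex fps)"
  define B where "B c = fps_binomial c oo f" for c
  define g where "g = fps_const (1 - y\<^sup>2) * fps_X ^ 2 * B (- 2)"
  have f0: "f $ 0 = 0" by (simp add: f_def)
  have Badd: "B (c + d) = B c * B d" for c d
    unfolding B_def by (rule fps_binomial_compose_add[OF f0])
  have Bpow: "B c ^ n = B (of_nat n * c)" for c n
    by (induction n) (simp_all add: Badd ring_distribs, simp add: B_def)
  have "B 2 = (1 + f) ^ 2"
    using fps_binomial_of_nat[of 2, where 'a = complex]
    by (simp add: B_def f0 fps_compose_add_distrib flip: fps_compose_power)
  hence inv: "(1 + f) ^ 2 * B (- 2) = 1"
    using Badd[of 2 "- 2"] by (simp add: B_def)
  \<comment> \<open>This is \<open>1 - 2yX + X\<^sup>2 = (1 - yX)\<^sup>2 (1 + g)\<close>.\<close>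
  have "f + f + f * f + g + (f + f + f * f) * g = fps_const (- 2 * y) * fps_X + fps_X ^ 2"
  proof -
    have "f + f + f * f + g + (f + f + f * f) * g = (1 + f) ^ 2 - 1 + (1 + f) ^ 2 * g"
      by (simp add: algebra_simps power2_eq_square)
    also have "(1 + f) ^ 2 * g = fps_const (1 - y\<^sup>2) * fps_X ^ 2 * ((1 + f) ^ 2 * B (- 2))"
      by (simp add: g_def mult_ac)
    also have "\<dots> = fps_const (1 - y\<^sup>2) * fps_X ^ 2"
      by (simp add: inv)
    also have "(1 + f) ^ 2 - 1 + fps_const (1 - y\<^sup>2) * fps_X ^ 2
        = fps_const (- 2 * y) * fps_X + fps_X ^ 2"
    proof -
      have const_eqs: "fps_const (1 - y\<^sup>2) = 1 - fps_const y ^ 2" "fps_const (- 2 * y) = - 2 * fps_const y"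
        by (simp_all add: fps_const_power numeral_fps_const)
      show ?thesis
        unfolding const_eqs f_def by (simp add: algebra_simps power2_eq_square flip: fps_const_neg)
    qed
    finally show ?thesis .
  qed
  hence "gegenbauer m v y = (fps_binomial (- v) oo (f + f + f * f + g + (f + f + f * f) * g)) $ m"
    by (metis gegenbauer_generating_function)
  also have "fps_binomial (- v) oo (f + f + f * f + g + (f + f + f * f) * g)
      = B (- 2 * v) * (fps_binomial (- v) oo g)"
  proof -
    have "fps_binomial (- v) oo (f + f + f * f) = B (- 2 * v)"
      using Badd[of "- v" "- v"] by (subst fps_binomial_compose_mult) (simp_all add: f0 B_def)
    moreover have "(f + f + f * f) $ 0 = 0" "g $ 0 = 0" by (simp_all add: f0 g_def)
    ultimately show ?thesis by (simp only: fps_binomial_compose_mult)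
  qed
  also have "\<dots> $ m = (\<Sum>j\<le>m. (- v gchoose j) * (B (- 2 * v) * g ^ j) $ m)"
    by (subst fps_mult_compose_nth) (simp_all add: g_def)
  also have "\<dots> = (\<Sum>j\<le>m. (- v gchoose j) * (1 - y\<^sup>2) ^ j *
      (if m < 2 * j then 0 else B (- 2 * v - 2 * of_nat j) $ (m - 2 * j)))"
  proof (intro sum.cong refl)
    fix j
    have "B (- 2 * v) * g ^ j = fps_const ((1 - y\<^sup>2) ^ j) * (fps_X ^ (2 * j) * B (- 2 * v - 2 * of_nat j))"
      using Badd[of "- 2 * v" "- 2 * of_nat j"]
      unfolding g_def power_mult_distrib Bpow fps_const_power power_mult
      by (simp add: mult_ac)
    thus "(- v gchoose j) * (B (- 2 * v) * g ^ j) $ m = (- v gchoose j) * (1 - y\<^sup>2) ^ j *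
      (if m < 2 * j then 0 else B (- 2 * v - 2 * of_nat j) $ (m - 2 * j))"
      by (simp add: fps_X_power_mult_nth)
  qed
  also have "\<dots> = (\<Sum>j\<le>m div 2. (- v gchoose j) * (1 - y\<^sup>2) ^ j *
      B (- 2 * v - 2 * of_nat j) $ (m - 2 * j))"
    by (rule sum.mono_neutral_cong_right) auto
  also have "\<dots> = (\<Sum>j\<le>m div 2. pochhammer v j * pochhammer (2 * v + 2 * of_nat j) (m - 2 * j)
        / (fact j * fact (m - 2 * j)) * (y\<^sup>2 - 1) ^ j * y ^ (m - 2 * j))"
  proof (intro sum.cong refl)
    fix j
    define r where "r = m - 2 * j"
    have "B (- 2 * v - 2 * of_nat j) $ r = pochhammer (2 * v + 2 * of_nat j) r / fact r * y ^ r"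
      using power_mult_distrib[of "- 1" "- y" r]
      unfolding B_def f_def fps_compose_linear by (simp add: gbinomial_pochhammer ac_simps)
    moreover have "(- v gchoose j) * (1 - y\<^sup>2) ^ j = pochhammer v j / fact j * (y\<^sup>2 - 1) ^ j"
      by (simp add: gbinomial_pochhammer mult_ac flip: power_mult_distrib)
    ultimately show "(- v gchoose j) * (1 - y\<^sup>2) ^ j * B (- 2 * v - 2 * of_nat j) $ (m - 2 * j) =
      pochhammer v j * pochhammer (2 * v + 2 * of_nat j) (m - 2 * j)
        / (fact j * fact (m - 2 * j)) * (y\<^sup>2 - 1) ^ j * y ^ (m - 2 * j)"
      by (simp add: r_def)
  qed
  finally show ?thesis .
qed


section \<open>The sum as a single coefficient\<close>

text \<open>
  With \<open>p = n + j\<close> and \<open>q = j + m\<close>, so that \<open>p + q = K\<close>, the symbol \<open>(2l + 2p)\<^sub>m\<close> and the part of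
  \<open>(2l + K)\<^sub>K\<close> beyond its first \<open>n\<close> factors fit together to \<open>(2l + 2p)\<^bsub>2q\<^esub>\<close>. Duplication splits this into
  \<open>(l + p)\<^sub>q\<close>, which completes \<open>(l)\<^sub>p\<close> to \<open>(l)\<^sub>K\<close>, and \<open>(l + p + 1/2)\<^sub>q\<close>, which is
  \<open>(1/2 - l - K)\<^sub>q\<close> up to sign. What depends on \<open>n\<close>, \<open>j\<close>, \<open>m\<close> other than through \<open>K\<close> is then a power
  of \<open>-4\<close> and one Pochhammer symbol.
\<close>

lemma pochhammer_weight_eq:
  fixes l :: complex
  defines "K \<equiv> \<lambda>n j m. n + 2 * j + m :: nat"
  assumes nz: "pochhammer (2 * l + of_nat (K n j m)) (K n j m) \<noteq> 0"
  shows "(-4) ^ (n + j) * pochhammer l (n + j) * pochhammer (2 * l + 2 * of_nat (n + j)) m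
           / pochhammer (2 * l + of_nat (K n j m)) n
         = (-4) ^ K n j m * pochhammer l (K n j m) / pochhammer (2 * l + of_nat (K n j m)) (K n j m)
             * pochhammer (1 / 2 - l - of_nat (K n j m)) (j + m)"
proof -
  define N where "N = K n j m"
  define c where "c = 2 * l + of_nat N"
  define p where "p = n + j"
  define q where "q = j + m"
  have N: "N = n + (2 * j + m)" "N = p + q" by (simp_all add: N_def K_def p_def q_def)
  have c_split: "pochhammer c N = pochhammer c n * pochhammer (c + of_nat n) (2 * j + m)"
    unfolding N(1) by (rule pochhammer_product')
  have nz': "pochhammer c N \<noteq> 0" using nz by (simp add: c_def N_def)
  hence nz_n: "pochhammer c n \<noteq> 0" by (simp add: c_split)
  have "pochhammer (2 * l + 2 * of_nat p) m * pochhammer (c + of_nat n) (2 * j + m)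
      = pochhammer (2 * (l + of_nat p)) (2 * q)"
    using pochhammer_product'[of "2 * l + 2 * of_nat p" m "2 * j + m"]
    by (simp add: c_def N p_def q_def algebra_simps mult_2)
  also have "\<dots> = 4 ^ q * pochhammer (l + of_nat p) q * pochhammer (l + of_nat p + 1 / 2) q"
    using pochhammer_double[of "l + of_nat p" q] by (simp add: power_mult distrib_left)
  finally have double: "pochhammer (2 * l + 2 * of_nat p) m * pochhammer (c + of_nat n) (2 * j + m)
      = 4 ^ q * pochhammer (l + of_nat p) q * pochhammer (l + of_nat p + 1 / 2) q" .
  have l_split: "pochhammer l N = pochhammer l p * pochhammer (l + of_nat p) q"
    unfolding N(2) by (rule pochhammer_product')
  have refl_q: "pochhammer (1 / 2 - l - of_nat N) q = (-1) ^ q * pochhammer (l + of_nat p + 1 / 2) q"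
    using pochhammer_minus[of "l + of_nat N - 1 / 2" q] by (simp add: N(2) algebra_simps)
  have "(-4) ^ p * pochhammer l p * pochhammer (2 * l + 2 * of_nat p) m * pochhammer c N
      = pochhammer c n * ((-4) ^ p * pochhammer l p
          * (pochhammer (2 * l + 2 * of_nat p) m * pochhammer (c + of_nat n) (2 * j + m)))"
    unfolding c_split by (simp add: mult_ac)
  also have "\<dots> = pochhammer c n * ((-4) ^ N * pochhammer l N * pochhammer (1 / 2 - l - of_nat N) q)"
  proof -
    have "(-4 :: complex) ^ N = (-4) ^ p * ((-1) ^ q * 4 ^ q)"
      using power_mult_distrib[of "-1 :: complex" 4 q] by (simp add: N(2) power_add)
    moreover have "(-1) ^ q * (-1) ^ q = (1 :: complex)"
      by simp
    ultimately show ?thesis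
      unfolding double refl_q l_split by (simp add: mult_ac)
  qed
  finally have "(-4) ^ p * pochhammer l p * pochhammer (2 * l + 2 * of_nat p) m / pochhammer c n
      = (-4) ^ N * pochhammer l N / pochhammer c N * pochhammer (1 / 2 - l - of_nat N) q"
    using nz' nz_n by (simp add: field_simps)
  thus ?thesis by (simp add: p_def q_def c_def N_def)
qed

text \<open>
  Here \<open>P u\<close> is \<open>(1 + uX)\<^bsup>-\<tau>\<^esup>\<close> with \<open>\<tau> = 1/2 - l - K\<close>. Everything that the Gegenbauer
  polynomials and the Pochhammer symbols contribute to the sum is collected in these two factors
  and in the constant in front.
\<close>

lemma gegenbauer_sum_eq_coefficient:
  fixes l y t :: complex and a :: "nat \<Rightarrow> complex" and K :: nat
  defines "P \<equiv> \<lambda>u. fps_binomial (l + of_nat K - 1 / 2) oo (fps_const u * fps_X)"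
  assumes nz: "pochhammer (2 * l + of_nat K) K \<noteq> 0"
  shows "(\<Sum>n\<le>K. pochhammer l n * a n * (- 2 * t) ^ n / pochhammer (2 * l + of_nat K) n
            * gegenbauer (K - n) (l + of_nat n) y)
       = (-4) ^ K * pochhammer l K / pochhammer (2 * l + of_nat K) K
            * (Abs_fps (\<lambda>n. a n * (t / 2) ^ n) * (P (- (y + 1) / 2) * P (- (y - 1) / 2))) $ K"
proof -
  define \<tau> where "\<tau> = 1 / 2 - l - of_nat K"
  define c where "c = 2 * l + of_nat K"
  define G where "G = (-4) ^ K * pochhammer l K / pochhammer c K"
  define W where "W = y\<^sup>2 - 1"
  define H where "H = Abs_fps (\<lambda>n. a n * (t / 2) ^ n)"
  define d where "d = fps_const (- y) + fps_const (W / 4) * fps_X"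
  define f where "f u = fps_const u * (fps_X :: complex fps)" for u
  \<comment> \<open>\<open>T n j\<close> is a term of the expanded left-hand side, \<open>R n j\<close> the matching term of the coefficient,
      where \<open>q = K - (n + j)\<close> is the exponent in \<open>(X d)\<^sup>q\<close>.\<close>
  define T where "T n j = pochhammer l n * a n * (- 2 * t) ^ n / pochhammer c n *
      (pochhammer (l + of_nat n) j * pochhammer (2 * (l + of_nat n) + 2 * of_nat j) (K - n - 2 * j)
        / (fact j * fact (K - n - 2 * j)) * W ^ j * y ^ (K - n - 2 * j))" for n j
  define R where "R n j = G * ((- \<tau> gchoose (K - (n + j))) * (H $ n * (d ^ (K - (n + j))) $ j))" for n j

  \<comment> \<open>The factorisation \<open>1 - yX + (y\<^sup>2 - 1) X\<^sup>2/4 = (1 - (y + 1)X/2)(1 - (y - 1)X/2)\<close>.\<close>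
  have product: "P (- (y + 1) / 2) * P (- (y - 1) / 2) = fps_binomial (- \<tau>) oo (fps_X * d)"
  proof -
    have "f (- (y + 1) / 2) + f (- (y - 1) / 2) + f (- (y + 1) / 2) * f (- (y - 1) / 2) = fps_X * d"
    proof -
      have "f (- (y + 1) / 2) + f (- (y - 1) / 2)
          = fps_const (- (y + 1) / 2 + - (y - 1) / 2) * fps_X"
        unfolding f_def fps_const_add [symmetric] by (simp only: distrib_right)
      moreover have "- (y + 1) / 2 + - (y - 1) / 2 = - y" by (simp add: field_simps)
      moreover have "f (- (y + 1) / 2) * f (- (y - 1) / 2)
          = fps_const ((- (y + 1) / 2) * (- (y - 1) / 2)) * (fps_X * fps_X)"
        unfolding f_def fps_const_mult [symmetric] by (simp only: mult_ac)
      moreover have "(- (y + 1) / 2) * (- (y - 1) / 2) = W / 4"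
        by (simp add: W_def field_simps power2_eq_square)
      ultimately show ?thesis by (simp add: d_def algebra_simps)
    qed
    moreover have "- \<tau> = l + of_nat K - 1 / 2" by (simp add: \<tau>_def)
    ultimately show ?thesis
      using fps_binomial_compose_mult[of "f (- (y + 1) / 2)" "f (- (y - 1) / 2)" "- \<tau>"]
      by (simp add: P_def f_def)
  qed

  \<comment> \<open>For \<open>n + 2j > K\<close> the term \<open>R n j\<close> vanishes because \<open>d\<close> is linear and \<open>j\<close> exceeds the exponent of \<open>d\<close>.\<close>
  have R_eq: "R n j = (if n + 2 * j \<le> K then T n j else 0)" if "n + j \<le> K" for n j
  proof (cases "n + 2 * j \<le> K")
    case False
    hence "K - (n + j) < j" using that by linarith
    thus ?thesis using False by (simp add: R_def d_def linear_fps_power_nth binomial_eq_0)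
  next
    case True
    then obtain m where K: "K = n + 2 * j + m" using le_Suc_ex by blast
    define q where "q = j + m"
    have Kq: "K - (n + j) = q" "K - n - 2 * j = m" by (simp_all add: K q_def)
    have dq: "(d ^ q) $ j = of_nat (q choose j) * (- y) ^ m * (W / 4) ^ j"
      by (simp add: d_def linear_fps_power_nth q_def)
    have choose: "of_nat (q choose j) = (fact q / (fact j * fact m) :: complex)"
      by (simp add: q_def binomial_fact)
    have gch: "(- \<tau> gchoose q) = (-1) ^ q * pochhammer \<tau> q / fact q"
      by (simp add: gbinomial_pochhammer)
    have weight: "G * pochhammer \<tau> q = (-4) ^ (n + j) * pochhammer l (n + j)
        * pochhammer (2 * l + 2 * of_nat (n + j)) m / pochhammer c n"
      using pochhammer_weight_eq[of l n j m] nz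
      by (simp add: G_def \<tau>_def c_def K q_def)
    have "R n j = (G * pochhammer \<tau> q) * ((-1) ^ q * (- y) ^ m * a n * (t / 2) ^ n * (W / 4) ^ j)
        / (fact j * fact m)"
      by (simp add: R_def Kq dq choose gch H_def)
    also have "\<dots> = (pochhammer l (n + j) * pochhammer (2 * l + 2 * of_nat (n + j)) m / pochhammer c n)
        * ((-4) ^ (n + j) * (-1) ^ q * (- y) ^ m * a n * (t / 2) ^ n * (W / 4) ^ j) / (fact j * fact m)"
      unfolding weight by (simp add: mult_ac)
    also have "(-4) ^ (n + j) * (-1) ^ q * (- y) ^ m * a n * (t / 2) ^ n * (W / 4) ^ j
        = a n * ((-4) ^ n * (t / 2) ^ n) * (((-4) ^ j * (-1) ^ j * (W / 4) ^ j)) * ((-1) ^ m * (- y) ^ m)"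
      by (simp add: q_def power_add)
    also have "\<dots> = a n * (- 2 * t) ^ n * W ^ j * y ^ m"
      by (simp flip: power_mult_distrib)
    also have "pochhammer l (n + j) = pochhammer l n * pochhammer (l + of_nat n) j"
      by (rule pochhammer_product')
    finally have "R n j = T n j"
      unfolding T_def Kq(2) by (simp add: algebra_simps)
    thus ?thesis using True by simp
  qed

  have "(\<Sum>n\<le>K. pochhammer l n * a n * (- 2 * t) ^ n / pochhammer c n * gegenbauer (K - n) (l + of_nat n) y)
      = (\<Sum>n\<le>K. \<Sum>j\<le>(K - n) div 2. T n j)"
    by (simp add: gegenbauer_eq_sum_square_minus_one T_def W_def sum_distrib_left)
  also have "\<dots> = (\<Sum>n\<le>K. \<Sum>j\<le>K - n. R n j)"
  proof (rule sum.cong)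
    fix n assume "n \<in> {..K}"
    hence "(\<Sum>j\<le>K - n. R n j) = (\<Sum>j\<le>K - n. if n + 2 * j \<le> K then T n j else 0)"
      by (intro sum.cong R_eq) auto
    also have "\<dots> = (\<Sum>j\<le>(K - n) div 2. T n j)"
      using \<open>n \<in> {..K}\<close> by (intro sum.mono_neutral_cong_right) (auto split: if_splits)
    finally show "(\<Sum>j\<le>(K - n) div 2. T n j) = (\<Sum>j\<le>K - n. R n j)" ..
  qed simp
  also have "\<dots> = (\<Sum>(n, j)\<in>{(n, j). n + j \<le> K}. R n j)"
    by (subst sum.Sigma) (auto intro!: sum.cong)
  also have "\<dots> = (\<Sum>p\<le>K. \<Sum>n\<le>p. R n (p - n))"
    by (rule sum.triangle_reindex_eq)
  also have "\<dots> = (\<Sum>p\<le>K. G * ((- \<tau> gchoose (K - p)) * (H * d ^ (K - p)) $ p))"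
    by (intro sum.cong refl) (simp add: R_def fps_mult_nth sum_distrib_left atLeast0AtMost)
  also have "\<dots> = G * (\<Sum>q\<le>K. (- \<tau> gchoose q) * (H * d ^ q) $ (K - q))"
    unfolding sum_distrib_left by (subst sum.nat_diff_reindex[symmetric, of _ "Suc K", unfolded lessThan_Suc_atMost]) simp
  also have "(\<Sum>q\<le>K. (- \<tau> gchoose q) * (H * d ^ q) $ (K - q))
      = (\<Sum>q\<le>K. (- \<tau> gchoose q) * (H * (fps_X * d) ^ q) $ K)"
  proof (intro sum.cong refl)
    fix q assume "q \<in> {..K}"
    have shift: "H * (fps_X * d) ^ q = fps_X ^ q * (H * d ^ q)"
      by (simp add: power_mult_distrib mult_ac)
    show "(- \<tau> gchoose q) * (H * d ^ q) $ (K - q)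
        = (- \<tau> gchoose q) * (H * (fps_X * d) ^ q) $ K"
      unfolding shift fps_X_power_mult_nth using \<open>q \<in> {..K}\<close> by simp
  qed
  also have "\<dots> = (H * (fps_binomial (- \<tau>) oo (fps_X * d))) $ K"
    by (subst fps_mult_compose_nth) simp_all
  finally show ?thesis
    unfolding product [symmetric] by (simp add: G_def H_def c_def)
qed

section \<open>Vanishing by parity\<close>

lemma fps_nth_odd_eq_0_if_compose_uminus:
  fixes F :: "'a::field_char_0 fps"
  assumes "F oo (- fps_X) = F" "odd n"
  shows "F $ n = 0"
  using arg_cong[OF assms(1), of "\<lambda>f. fps_nth f n"] \<open>odd n\<close>
  by (simp add: fps_compose_uminus' eq_neg_iff_add_eq_0 neg_eq_iff_add_eq_0)

text \<open>
  The conditions on \<open>u\<close> and \<open>v\<close> say that after \<open>X \<mapsto> tX/2\<close> the two linear factors of \<open>A\<close> become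
  \<open>1 - (y - 1)X/2\<close> and \<open>1 + (y + 1)X/2\<close>: the first cancels one factor contributed by the Gegenbauer
  polynomials, the second is the mirror image of the other one.
\<close>

lemma gegenbauer_sum_eq_0:
  fixes l y t r u v e :: complex and K :: nat
  defines "\<tau> \<equiv> 1 / 2 - l - of_nat K"
  defines "A \<equiv> (fps_binomial \<tau> oo (fps_const u * fps_X)) * (fps_binomial (- \<tau>) oo (fps_const v * fps_X))
                * (fps_binomial (- r) oo (fps_const e * fps_X\<^sup>2))"
  assumes "odd K" and nz: "pochhammer (2 * l + of_nat K) K \<noteq> 0"
    and u: "t * u = 1 - y" and v: "t * v = 1 + y"
  shows "(\<Sum>n\<le>K. pochhammer l n * A $ n * (- 2 * t) ^ n / pochhammer (2 * l + of_nat K) n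
            * gegenbauer (K - n) (l + of_nat n) y) = 0"
proof -
  define L where "L b w = fps_binomial b oo (fps_const w * fps_X)" for b w :: complex
  define Q where "Q w = fps_binomial (- r) oo (fps_const w * fps_X\<^sup>2)" for w :: complex
  define s where "s = (1 + y) / 2"
  define s' where "s' = (1 - y) / 2"
  have dilate_mult: "(F * F') oo (fps_const w * fps_X) = (F oo (fps_const w * fps_X)) * (F' oo (fps_const w * fps_X))"
    for F F' :: "complex fps" and w
    by (simp add: fps_compose_mult_distrib)
  have L_dilate: "L b w oo (fps_const w' * fps_X) = L b (w * w')" for b w w'
    using fps_compose_monomial_dilate[of "fps_binomial b" w 0 w'] by (simp add: L_def)
  have Q_dilate: "Q w oo (fps_const w' * fps_X) = Q (w * w'\<^sup>2)" for w w'
    using fps_compose_monomial_dilate[of "fps_binomial (- r)" w 1 w']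
    by (simp add: Q_def flip: numeral_2_eq_2)
  have L_cancel: "L \<tau> w * L (- \<tau>) w = 1" for w
    using fps_binomial_compose_add[of "fps_const w * fps_X" \<tau> "- \<tau>"] by (simp add: L_def)

  have "Abs_fps (\<lambda>n. A $ n * (t / 2) ^ n) = A oo (fps_const (t / 2) * fps_X)"
    unfolding fps_compose_linear by (simp add: mult.commute)
  also have "\<dots> = L \<tau> (u * (t / 2)) * L (- \<tau>) (v * (t / 2)) * Q (e * (t / 2)\<^sup>2)"
    unfolding A_def L_def [symmetric] Q_def [symmetric] dilate_mult L_dilate Q_dilate ..
  also have "u * (t / 2) = s'" using u by (simp add: s'_def mult.commute)
  also have "v * (t / 2) = s" using v by (simp add: s_def mult.commute)
  finally have A: "Abs_fps (\<lambda>n. A $ n * (t / 2) ^ n) = L \<tau> s' * L (- \<tau>) s * Q (e * (t / 2)\<^sup>2)" .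

  define E where "E = L (- \<tau>) s * L (- \<tau>) (- s) * Q (e * (t / 2)\<^sup>2)"
  have "- (y + 1) / 2 = - s" "- (y - 1) / 2 = s'"
    by (simp_all add: s_def s'_def field_simps)
  hence "Abs_fps (\<lambda>n. A $ n * (t / 2) ^ n) * (L (- \<tau>) (- (y + 1) / 2) * L (- \<tau>) (- (y - 1) / 2))
      = (L \<tau> s' * L (- \<tau>) s') * E"
    by (simp only: A E_def mult_ac)
  also have "\<dots> = E" by (simp add: L_cancel)
  finally have coefficient: "Abs_fps (\<lambda>n. A $ n * (t / 2) ^ n)
      * (L (- \<tau>) (- (y + 1) / 2) * L (- \<tau>) (- (y - 1) / 2)) = E" .

  have "E oo (fps_const (-1) * fps_X) = E"
    unfolding E_def dilate_mult L_dilate Q_dilate by (simp add: mult_ac)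
  hence "E $ K = 0"
    using \<open>odd K\<close> by (intro fps_nth_odd_eq_0_if_compose_uminus) (simp_all flip: fps_const_neg)
  moreover have "- \<tau> = l + of_nat K - 1 / 2" by (simp add: \<tau>_def)
  ultimately show ?thesis
    using coefficient by (subst gegenbauer_sum_eq_coefficient[OF nz]) (simp add: L_def)
qed

section \<open>The coefficients of the two generating functions\<close>

lemma powr_one_plus_monomial_has_fps_expansion:
  "(\<lambda>z. (1 + c * z ^ Suc n) powr b) has_fps_expansion
     (fps_binomial b oo (fps_const c * fps_X ^ Suc n))" for b c :: complex
proof -
  have "((\<lambda>x. (1 + x) powr b) \<circ> (\<lambda>z. c * z ^ Suc n)) has_fps_expansion
      (fps_binomial b oo (fps_const c * fps_X ^ Suc n))"
    by (intro fps_expansion_intros) simp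
  thus ?thesis by (simp add: o_def)
qed

lemma coeff_G_eq:
  "coeff_G n b r w = ((fps_binomial b oo (fps_const (- w) * fps_X))
      * (fps_binomial (- b) oo (fps_const (1 / w) * fps_X))
      * (fps_binomial (- r) oo (fps_const 1 * fps_X\<^sup>2))) $ n"
proof -
  have "(\<lambda>z. (1 + (- w) * z ^ Suc 0) powr b * (1 + (1 / w) * z ^ Suc 0) powr (- b)
            * (1 + 1 * z ^ Suc 1) powr (- r)) has_fps_expansion
     ((fps_binomial b oo (fps_const (- w) * fps_X ^ Suc 0))
      * (fps_binomial (- b) oo (fps_const (1 / w) * fps_X ^ Suc 0))
      * (fps_binomial (- r) oo (fps_const 1 * fps_X ^ Suc 1)))"
    by (intro has_fps_expansion_mult powr_one_plus_monomial_has_fps_expansion)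
  moreover have "(\<lambda>z. (1 + (- w) * z ^ Suc 0) powr b * (1 + (1 / w) * z ^ Suc 0) powr (- b)
            * (1 + 1 * z ^ Suc 1) powr (- r)) = genfun_G b r w"
    by (auto simp: genfun_G_def fun_eq_iff power2_eq_square)
  ultimately show ?thesis
    by (simp add: coeff_G_def fps_expansion_eqI power2_eq_square)
qed

lemma coeff_G_hat_eq:
  "coeff_G_hat n b r w = ((fps_binomial b oo (fps_const w * fps_X))
      * (fps_binomial (- b) oo (fps_const (1 / w) * fps_X))
      * (fps_binomial (- r) oo (fps_const (- 1) * fps_X\<^sup>2))) $ n"
proof -
  have "(\<lambda>z. (1 + w * z ^ Suc 0) powr b * (1 + (1 / w) * z ^ Suc 0) powr (- b)
            * (1 + (- 1) * z ^ Suc 1) powr (- r)) has_fps_expansion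
     ((fps_binomial b oo (fps_const w * fps_X ^ Suc 0))
      * (fps_binomial (- b) oo (fps_const (1 / w) * fps_X ^ Suc 0))
      * (fps_binomial (- r) oo (fps_const (- 1) * fps_X ^ Suc 1)))"
    by (intro has_fps_expansion_mult powr_one_plus_monomial_has_fps_expansion)
  moreover have "(\<lambda>z. (1 + w * z ^ Suc 0) powr b * (1 + (1 / w) * z ^ Suc 0) powr (- b)
            * (1 + (- 1) * z ^ Suc 1) powr (- r)) = genfun_G_hat b r w"
    by (auto simp: genfun_G_hat_def fun_eq_iff power2_eq_square)
  ultimately show ?thesis
    by (simp add: coeff_G_hat_def fps_expansion_eqI power2_eq_square)
qed

section \<open>The connecting formulas\<close>

theorem corollary17:
  fixes l :: complex and k :: nat and x :: real
  assumes "0 < x" and "x < 1"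
    and "\<forall>n \<le> 2 * k + 1. pochhammer (2 * l + 2 * of_nat k + 1) n \<noteq> 0"
  shows "(\<Sum>n = 0..2 * k + 1.
            pochhammer l n
              * coeff_G n (- 2 * of_nat k - l - 1 / 2) (l - 1 / 2)
                  (complex_of_real (sqrt ((1 - x) / (1 + x))))
            / (pochhammer (2 * l + 2 * of_nat k + 1) n * (- 2) powi (- int n)
                 * complex_of_real ((1 - x\<^sup>2) powr (- (real n / 2)))
                 * complex_of_real x ^ n)
            * gegenbauer (2 * k + 1 - n) (l + of_nat n) (complex_of_real (1 / x))) = 0
       \<and> (\<Sum>n = 0..2 * k + 1.
            pochhammer l n
              * coeff_G_hat n (- 2 * of_nat k - l - 1 / 2) (l - 1 / 2)
                  (complex_of_real (sqrt ((1 - x) / (1 + x))))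
            / (pochhammer (2 * l + 2 * of_nat k + 1) n * (- 2) powi (- int n)
                 * complex_of_real ((1 - x\<^sup>2) powr (- (real n / 2))))
            * gegenbauer (2 * k + 1 - n) (l + of_nat n) (complex_of_real x)) = 0"
proof -
  define K where "K = 2 * k + 1"
  \<comment> \<open>\<open>s w = 1 - x\<close> and \<open>s / w = 1 + x\<close> are the conditions on the linear factors for \<open>y = x\<close> and
      \<open>t = s\<close>; dividing by \<open>x\<close> gives those for \<open>y = 1/x\<close> and \<open>t = s/x\<close>.\<close>
  define s where "s = sqrt (1 - x\<^sup>2)"
  define w where "w = sqrt ((1 - x) / (1 + x))"
  define c where "c = 2 * l + of_nat K"
  define b where "b = 1 / 2 - l - of_nat K"
  have c_eq: "2 * l + 2 * of_nat k + 1 = c" and b_eq: "- 2 * of_nat k - l - 1 / 2 = b"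
    by (simp_all add: c_def b_def K_def)
  have "odd K" by (simp add: K_def)
  have nz: "pochhammer (2 * l + of_nat K) K \<noteq> 0"
    using assms(3)[unfolded c_eq] by (simp add: c_def K_def)
  have pos: "1 - x\<^sup>2 > 0" "(1 - x) / (1 + x) > 0"
    using assms(1,2) by (simp_all add: power_less_one_iff abs_square_less_1)
  have "s > 0" "w > 0" using pos by (simp_all add: s_def w_def)
  have "1 - x\<^sup>2 = (1 - x) * (1 + x)" by (simp add: power2_eq_square algebra_simps)
  hence "s = sqrt (1 - x) * sqrt (1 + x)" "w = sqrt (1 - x) / sqrt (1 + x)"
    by (simp_all add: s_def w_def real_sqrt_mult real_sqrt_divide)
  hence sw: "s * w = 1 - x" and sw': "s * (1 / w) = 1 + x"
    using assms(1,2) by simp_all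
  have weight: "(- 2) powi (- int n) * complex_of_real ((1 - x\<^sup>2) powr (- (real n / 2)))
      = 1 / (- 2 * complex_of_real s) ^ n" for n
  proof -
    have "(1 - x\<^sup>2) powr (- (real n / 2)) = 1 / ((1 - x\<^sup>2) powr (1 / 2)) powr real n"
      by (simp add: powr_powr powr_minus_divide)
    also have "\<dots> = 1 / s ^ n"
      using pos \<open>s > 0\<close> by (simp add: powr_half_sqrt s_def powr_realpow)
    finally show ?thesis
      unfolding power_mult_distrib by (simp add: power_int_minus field_simps)
  qed

  have "(\<Sum>n\<le>K. pochhammer l n * coeff_G n b (l - 1 / 2) w * (- 2 * of_real (s / x)) ^ n
            / pochhammer c n * gegenbauer (K - n) (l + of_nat n) (of_real (1 / x))) = 0"
    unfolding coeff_G_eq b_def c_def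
  proof (rule gegenbauer_sum_eq_0[OF \<open>odd K\<close> nz])
    have "s / x * - w = 1 - 1 / x" "s / x * (1 / w) = 1 + 1 / x"
      using sw sw' assms(1) by (simp_all add: field_simps)
    from this[THEN arg_cong, of complex_of_real]
    show "complex_of_real (s / x) * - complex_of_real w = 1 - complex_of_real (1 / x)"
      "complex_of_real (s / x) * (1 / complex_of_real w) = 1 + complex_of_real (1 / x)"
      by (simp_all only: of_real_1 of_real_add of_real_diff of_real_divide of_real_minus of_real_mult)
  qed
  moreover have "(\<Sum>n\<le>K. pochhammer l n * coeff_G_hat n b (l - 1 / 2) w * (- 2 * of_real s) ^ n
            / pochhammer c n * gegenbauer (K - n) (l + of_nat n) (of_real x)) = 0"
    unfolding coeff_G_hat_eq b_def c_def
  proof (rule gegenbauer_sum_eq_0[OF \<open>odd K\<close> nz])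
    show "complex_of_real s * complex_of_real w = 1 - complex_of_real x"
      "complex_of_real s * (1 / complex_of_real w) = 1 + complex_of_real x"
      using sw[THEN arg_cong, of complex_of_real] sw'[THEN arg_cong, of complex_of_real]
      by (simp_all only: of_real_1 of_real_add of_real_diff of_real_divide of_real_mult)
  qed
  moreover have "C / (p * (- 2) powi (- int n) * complex_of_real ((1 - x\<^sup>2) powr (- (real n / 2)))
      * complex_of_real x ^ n) = C * (- 2 * of_real (s / x)) ^ n / p" for n C p
  proof -
    have "(- 2 * complex_of_real (s / x)) ^ n = (- 2 * complex_of_real s) ^ n / complex_of_real x ^ n"
      using power_divide[of "- 2 * complex_of_real s" "complex_of_real x" n] by simp
    thus ?thesis unfolding mult.assoc[of p] weight by (simp add: mult_ac)
  qed
  moreover have "C / (p * (- 2) powi (- int n) * complex_of_real ((1 - x\<^sup>2) powr (- (real n / 2))))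
      = C * (- 2 * of_real s) ^ n / p" for n C p
    unfolding mult.assoc[of p] weight by simp
  ultimately show ?thesis
    unfolding c_eq b_eq w_def K_def atLeast0AtMost by (simp only: conj_absorb)
qed

end
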